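(* Let $c>0$, $L>0$ and suppose that $2\pi cL<1$. Let $\omega$ solve $$\partial_\tau\omega(\eta)+\frac c2\frac{1}{k^2+(\eta+1-\tau)^2}\,\omega(\eta+1)-\frac c2\frac{1}{k^2+(\eta-1-\tau)^2}\,\omega(\eta-1)=0$$ with initial data $\omega|_{\tau=0}=\omega_0$. Then for all $\tau\ge0$ and all $\eta$ it holds that $$|\omega(\tau,\eta)-\omega_0(\eta)|\le\frac{1}{1-2\pi cL}\,\Big((2\pi cL)^{|\cdot|}*|\omega_0|\Big)(\eta),$$ where $*$ denotes the (discrete) convolution in the frequency $\eta$, i.e. $\big((2\pi cL)^{|\cdot|}*|\omega_0|\big)(\eta)=\sum_{\eta_0\in\eta+\mathbb{Z}}(2\pi cL)^{|\eta-\eta_0|}|\omega_0(\eta_0)|$. In particular, the evolution is stable in $H^s$ for any $s>0$ (there is $C_s$ with $\|\omega(\tau)\|_{H^s}\le C_s\|\omega_0\|_{H^s}$ for all $\tau\ge0$), and in Gevrey regularity (there exists $C_0$ such that if $\int e^{C|\eta|}|\omega_0(\eta)|^2<\infty$ for some $C>C_0$, then $\int e^{(C-C_0)|\eta|}|\omega(\tau,\eta)|^2<\infty$ for all $\tau\ge0$).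
   Context: The unknown $\omega(\tau,k,\eta)$ (with $k$, and sometimes $\tau$, suppressed) is the Fourier transform of $W$ solving $\partial_tW+c\sin(y)\partial_x\Delta_t^{-1}W=0$ on $\mathbb{T}_L\times\mathbb{R}$, $\Delta_t=\partial_x^2+(\partial_y-t\partial_x)^2$, with rescaled time $\tau=kt$. $\mathbb{T}_L$ is the torus of length $2\pi L$, so the $x$-frequency is $k\in\frac1L\mathbb{Z}\setminus\{0\}$, which is arbitrary but fixed as the system decouples in $k$; $\eta$ is the frequency in $y$. Since only nearest neighbors in $\eta$ interact, the system decouples into problems on $\eta\in\eta^*+\mathbb{Z}$, $\eta^*\in[0,1)$. $H^s$ norms are computed on the Fourier side.
   Formalization: The solution ω is additionally assumed to grow at most exponentially along each lattice η+ℤ, locally uniformly in τ (any rate); without such a condition the infinite system has nonzero solutions with ω₀=0, so the stated bound fails. *)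

theory Defs
  imports "HOL-Analysis.Analysis"
begin

(* Nonzero x-frequencies on the torus of length 2 * pi * L. *)
definition x_freqs :: "real \<Rightarrow> real set" where
  "x_freqs L = {of_int m / L | m :: int. m \<noteq> 0}"

(* The values omega(tau, eta) are indexed by all real eta; a solution on a single lattice
   eta* + Z is the special case of a function vanishing off that lattice.
   At tau = 0 the derivative is one-sided. *)
definition solves_system ::
  "real \<Rightarrow> real \<Rightarrow> (real \<Rightarrow> complex) \<Rightarrow> (real \<Rightarrow> real \<Rightarrow> complex) \<Rightarrow> bool" where
  "solves_system c k \<omega>\<^sub>0 \<omega> \<longleftrightarrow>
     \<omega> 0 = \<omega>\<^sub>0 \<and>
     (\<forall>\<tau>\<ge>0. \<forall>\<eta>. \<exists>D.
        ((\<lambda>t. \<omega> t \<eta>) has_vector_derivative D) (at \<tau> within {0..}) \<and>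
        D + of_real (c / 2 * (1 / (k\<^sup>2 + (\<eta> + 1 - \<tau>)\<^sup>2))) * \<omega> \<tau> (\<eta> + 1)
          - of_real (c / 2 * (1 / (k\<^sup>2 + (\<eta> - 1 - \<tau>)\<^sup>2))) * \<omega> \<tau> (\<eta> - 1) = 0)"

(* Solution class. Without a growth condition along eta + Z the infinite system has nonzero
   solutions with zero initial data: prescribe omega(., eta) and omega(., eta + 1) arbitrarily,
   flat at tau = 0, and solve the equations recursively for the remaining modes.
   Exponential growth of arbitrary rate, locally uniformly in tau, is allowed; this contains
   all evolutions that are locally bounded in time with square summable (or tempered) values
   on the lattices. *)
definition exp_growth :: "(real \<Rightarrow> real \<Rightarrow> complex) \<Rightarrow> bool" where
  "exp_growth \<omega> \<longleftrightarrow>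
     (\<forall>T\<ge>0. \<forall>\<eta>. \<exists>M R. \<forall>\<tau>\<in>{0..T}. \<forall>n::int.
        cmod (\<omega> \<tau> (\<eta> + of_int n)) \<le> M * R ^ nat \<bar>n\<bar>)"

(* Intended for nonnegative g and f; the value is infinite if the series diverges. *)
definition freq_conv :: "(real \<Rightarrow> real) \<Rightarrow> (real \<Rightarrow> real) \<Rightarrow> real \<Rightarrow> ennreal" where
  "freq_conv g f \<eta> =
     (\<Sum>\<^sub>\<infinity>\<eta>\<^sub>0\<in>range (\<lambda>n::int. \<eta> + of_int n). ennreal (g (\<eta> - \<eta>\<^sub>0) * f \<eta>\<^sub>0))"

(* The arguments f below are Fourier transforms, as functions of the frequency eta. *)

definition in_Hs :: "real \<Rightarrow> (real \<Rightarrow> complex) \<Rightarrow> bool" where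
  "in_Hs s f \<longleftrightarrow> f \<in> borel_measurable lebesgue \<and>
     integrable lebesgue (\<lambda>\<eta>. (1 + \<eta>\<^sup>2) powr s * (cmod (f \<eta>))\<^sup>2)"

definition Hs_norm :: "real \<Rightarrow> (real \<Rightarrow> complex) \<Rightarrow> real" where
  "Hs_norm s f = sqrt (LINT \<eta>|lebesgue. (1 + \<eta>\<^sup>2) powr s * (cmod (f \<eta>))\<^sup>2)"

definition in_Gevrey :: "real \<Rightarrow> (real \<Rightarrow> complex) \<Rightarrow> bool" where
  "in_Gevrey C f \<longleftrightarrow> f \<in> borel_measurable lebesgue \<and>
     integrable lebesgue (\<lambda>\<eta>. exp (C * \<bar>\<eta>\<bar>) * (cmod (f \<eta>))\<^sup>2)"

end

theory Submission
  imports Defs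
begin

text \<open>
  On each lattice \<open>\<eta> + \<int>\<close> the solution is the limit of the Picard iterates. The total coupling
  \<open>\<integral> c / 2 / (k\<^sup>2 + (\<eta> - \<tau>)\<^sup>2) d\<tau>\<close> over all times is \<open>c \<pi> / (2 \<bar>k\<bar>) \<le> \<rho> / 4\<close> with
  \<open>\<rho> = 2 \<pi> c L\<close>, so a majorant \<open>F\<close> of the data with \<open>\<rho> F (\<eta> \<plusminus> 1) \<le> F \<eta>\<close> satisfies
  \<open>\<bar>\<omega> - \<omega>\<^sub>0\<bar> \<le> F\<close>. The convolution of \<open>\<bar>\<omega>\<^sub>0\<bar>\<close> with \<open>\<rho>\<^bsup>\<bar>\<cdot>\<bar>\<^esup>\<close> is such a majorant,
  and so is the square root of the convolution of \<open>\<bar>\<omega>\<^sub>0\<bar>\<^sup>2\<close> with \<open>\<rho>\<^bsup>2\<bar>\<cdot>\<bar>\<^esup>\<close>. The latter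
  gives \<open>H\<^sup>s\<close> stability, since the weight grows only polynomially under translation. For Gevrey
  weights \<open>\<rho>\<close> is replaced by an arbitrarily small \<open>r\<close> at the price of a factor growing
  exponentially in time; the statement is qualitative for each time, so \<open>C\<^sub>0 = 0\<close> suffices.
\<close>

section \<open>Picard iteration\<close>

text \<open>Mean value inequality against a scalar comparison function. At interior times the
  one-sided derivatives are ordinary ones, and at the end points continuity is enough. All time
  estimates below use it with an explicit \<open>g\<close>, so no integral has to be bounded
  directly.\<close>

lemma norm_increment_le:
  fixes f :: "real \<Rightarrow> 'a::real_normed_vector"
  assumes f: "\<And>s. 0 \<le> s \<Longrightarrow> (f has_vector_derivative f' s) (at s within {0..})"
    and g: "\<And>s. 0 \<le> s \<Longrightarrow> (g has_real_derivative g' s) (at s within {0..})"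
    and le: "\<And>s. 0 \<le> s \<Longrightarrow> s \<le> t \<Longrightarrow> norm (f' s) \<le> g' s" and "0 \<le> t"
  shows "norm (f t - f 0) \<le> g t - g 0"
proof (cases "t = 0")
  case False
  with \<open>0 \<le> t\<close> have t: "0 < t" by simp
  have sub: "at s within {0..t} \<le> at s within {0..}" for s :: real
    by (rule at_le) auto
  have at: "at s within {0..} = at s" if "0 < s" for s :: real
    using that by (intro at_within_interior) auto
  show ?thesis
  proof (rule differentiable_bound_general[OF t])
    show "continuous_on {0..t} f"
      by (intro continuous_on_vector_derivative)
        (auto intro: has_vector_derivative_within_subset[OF f])
    show "continuous_on {0..t} g"
      by (intro DERIV_continuous_on) (auto intro: DERIV_subset[OF g])
    show "(f has_vector_derivative f' s) (at s)" if "0 < s" "s < t" for s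
      using f[of s] at[OF that(1)] that by simp
    show "(g has_vector_derivative g' s) (at s)" if "0 < s" "s < t" for s
      using g[of s] at[OF that(1)] that by (simp add: has_real_derivative_iff_has_vector_derivative)
    show "norm (f' s) \<le> g' s" if "0 < s" "s < t" for s
      using le that by simp
  qed
qed simp

text \<open>The fundamental theorem is available for the gauge integral, which agrees with the
  Lebesgue integral for continuous integrands. Passing from \<open>{0..s+1}\<close> to
  \<open>{0..}\<close> is harmless because differentiability at \<open>s\<close> is local.\<close>

lemma integral_has_vector_derivative_atLeast:
  fixes f :: "real \<Rightarrow> 'a::euclidean_space"
  assumes f: "continuous_on {0..} f" and "0 \<le> s"
  shows "((\<lambda>t. z + (LINT u:{0..t}|lborel. f u)) has_vector_derivative f s) (at s within {0..})"
proof -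
  have c: "continuous_on {0..t} f" for t
    using f by (rule continuous_on_subset) auto
  have eq: "(LINT u:{0..t}|lborel. f u) = integral {0..t} f" for t
    by (intro set_borel_integral_eq_integral(2) borel_integrable_atLeastAtMost' c)
  have "((\<lambda>t. integral {0..t} f) has_vector_derivative f s) (at s within {0..s+1})"
    using c assms by (intro integral_has_vector_derivative) auto
  moreover have "at s within {0..s+1} = at s within {0..}"
    by (rule at_within_nhd[of _ "{..<s+1}"]) auto
  ultimately show ?thesis
    using has_vector_derivative_add[OF has_vector_derivative_const[of z]] by (simp add: eq)
qed

lemma lebesgue_translation_measurable [measurable]:
  "(\<lambda>x. x + a) \<in> lebesgue \<rightarrow>\<^sub>M lebesgue" for a :: real
  using lebesgue_affine_measurable[of "\<lambda>_. 1" a] by (simp add: add.commute)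

section \<open>A fixed x-frequency: the coupling and the regularity of the Picard iterates\<close>

locale shear_modes =
  fixes c k :: real
  assumes c_pos: "0 < c" and k_nz: "k \<noteq> 0"
begin

text \<open>Here \<open>x\<close> is the frequency of the neighbour that acts, not of the mode acted
  upon; the coupling peaks at the critical time \<open>s = x\<close>.\<close>

definition coupling :: "real \<Rightarrow> real \<Rightarrow> real" where
  "coupling x s = c / 2 * (1 / (k\<^sup>2 + (x - s)\<^sup>2))"

definition rhs :: "(real \<Rightarrow> real \<Rightarrow> complex) \<Rightarrow> real \<Rightarrow> real \<Rightarrow> complex" where
  "rhs f s x = of_real (coupling (x - 1) s) * f s (x - 1) - of_real (coupling (x + 1) s) * f s (x + 1)"

text \<open>Starting from 0 instead of the data makes the growth bound on the solution itself the
  base case of the remainder estimate. The Lebesgue integral gives measurability in the parameters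
  \<open>x\<close> and \<open>t\<close>.\<close>

primrec picard :: "(real \<Rightarrow> complex) \<Rightarrow> nat \<Rightarrow> real \<Rightarrow> real \<Rightarrow> complex" where
  "picard f 0 = (\<lambda>t x. 0)"
| "picard f (Suc j) = (\<lambda>t x. f x + (LINT s:{0..t}|lborel. rhs (picard f j) s x))"

lemma denominator_pos: "0 < k\<^sup>2 + (x - s)\<^sup>2"
  using k_nz by (simp add: add_pos_nonneg)

lemma coupling_nonneg: "0 \<le> coupling x s"
  using c_pos denominator_pos[of x s] by (simp add: coupling_def)

lemma coupling_le: "coupling x s \<le> c / (2 * k\<^sup>2)"
  using c_pos k_nz denominator_pos[of x s]
  by (simp add: coupling_def frac_le)

lemma continuous_on_coupling: "continuous_on S (coupling x)"
  unfolding coupling_def using denominator_pos[of x]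
  by (intro continuous_intros) (metis less_irrefl)

text \<open>The arctangent has total increment at most \<open>pi\<close>, so one neighbour
  contributes at most \<open>c * pi / (2 * \<bar>k\<bar>)\<close> over all times. This is the source
  of bounds uniform in time.\<close>

lemma coupling_antiderivative:
  "((\<lambda>s. c / (2 * \<bar>k\<bar>) * arctan ((s - x) / \<bar>k\<bar>)) has_real_derivative coupling x s) (at s within S)"
proof -
  define D where "D = k\<^sup>2 + (x - s)\<^sup>2"
  have "D \<noteq> 0"
    using denominator_pos[of x s] unfolding D_def by (rule less_imp_neq[symmetric])
  have "1 + ((s - x) / \<bar>k\<bar>)\<^sup>2 = D / k\<^sup>2"
    using k_nz unfolding D_def by (simp add: field_simps power2_eq_square)
  moreover have "c / (2 * \<bar>k\<bar>) * (k\<^sup>2 / D * (1 / \<bar>k\<bar>)) = coupling x s"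
  proof -
    have "k\<^sup>2 = \<bar>k\<bar> * \<bar>k\<bar>" and "coupling x s = c / 2 * (1 / D)"
      by (simp_all add: coupling_def D_def power2_eq_square)
    then show ?thesis
      using k_nz \<open>D \<noteq> 0\<close> by (simp del: abs_mult_self_eq add: divide_simps)
  qed
  ultimately have "c / (2 * \<bar>k\<bar>) * (inverse (1 + ((s - x) / \<bar>k\<bar>)\<^sup>2) * (1 / \<bar>k\<bar>)) = coupling x s"
    by simp
  moreover have "((\<lambda>s. (s - x) / \<bar>k\<bar>) has_real_derivative 1 / \<bar>k\<bar>) (at s within S)"
    by (rule DERIV_cdivide[OF DERIV_diff[OF DERIV_ident DERIV_const[of x]], simplified])
  from DERIV_cmult[OF DERIV_chain2[OF DERIV_arctan this], of "c / (2 * \<bar>k\<bar>)"]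
  have "((\<lambda>s. c / (2 * \<bar>k\<bar>) * arctan ((s - x) / \<bar>k\<bar>)) has_real_derivative
      c / (2 * \<bar>k\<bar>) * (inverse (1 + ((s - x) / \<bar>k\<bar>)\<^sup>2) * (1 / \<bar>k\<bar>))) (at s within S)" .
  ultimately show ?thesis by simp
qed

lemma norm_rhs_le:
  assumes "cmod (f s (x + 1)) \<le> a" and "cmod (f s (x - 1)) \<le> b"
  shows "cmod (rhs f s x) \<le> coupling (x + 1) s * a + coupling (x - 1) s * b"
proof -
  have "cmod (rhs f s x) \<le> coupling (x - 1) s * cmod (f s (x - 1)) + coupling (x + 1) s * cmod (f s (x + 1))"
    unfolding rhs_def using coupling_nonneg
    by (intro norm_triangle_le_diff) (simp add: norm_mult)
  also have "\<dots> \<le> coupling (x - 1) s * b + coupling (x + 1) s * a"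
    using assms coupling_nonneg by (intro add_mono mult_left_mono) auto
  finally show ?thesis by simp
qed

text \<open>Induction: differentiability of one iterate makes it continuous in time, hence the next
  integrand is continuous and the fundamental theorem applies.\<close>

lemma picard_derivative:
  assumes "0 \<le> t"
  shows "((\<lambda>s. picard f (Suc j) s x) has_vector_derivative rhs (picard f j) t x) (at t within {0..})"
  using assms
proof (induction j arbitrary: t x)
  case 0
  have "continuous_on {0..} (\<lambda>s. rhs (picard f 0) s x)"
    by (simp add: rhs_def)
  from integral_has_vector_derivative_atLeast[OF this 0] show ?case
    by (simp only: picard.simps(2))
next
  case (Suc j)
  have c: "continuous_on {0..} (\<lambda>s. picard f (Suc j) s x)" for x
    using Suc.IH by (intro continuous_on_vector_derivative) auto
  have "continuous_on {0..} (\<lambda>s. rhs (picard f (Suc j)) s x)"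
    unfolding rhs_def by (intro continuous_intros c continuous_on_coupling)
  from integral_has_vector_derivative_atLeast[OF this Suc.prems] show ?case
    by (simp only: picard.simps(2)[of _ "Suc j"])
qed

lemma picard_at_0: "picard f (Suc j) 0 x = f x"
proof -
  have "(LINT s:{0..0::real}|lborel. rhs (picard f j) s x) = integral {0..0} (\<lambda>s. rhs (picard f j) s x)"
    by (intro set_borel_integral_eq_integral(2) borel_integrable_atLeastAtMost') simp
  then show ?thesis by simp
qed

text \<open>Joint measurability is what passes through the recursion, since each step integrates
  over time with the frequency as a parameter. The frequency carries the Lebesgue sigma-algebra
  because the data are only Lebesgue measurable.\<close>

lemma picard_measurable_pair:
  assumes [measurable]: "f \<in> borel_measurable lebesgue"
  shows "(\<lambda>(x, t). picard f j t x) \<in> borel_measurable (lebesgue \<Otimes>\<^sub>M borel)"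
proof (induction j)
  case 0
  then show ?case by simp
next
  case (Suc j)
  note [measurable] = Suc
  have shift [measurable]: "(\<lambda>((x, t), s). picard f j s (x + a))
      \<in> borel_measurable ((lebesgue \<Otimes>\<^sub>M borel) \<Otimes>\<^sub>M lborel)" for a
  proof -
    have "(\<lambda>p. (fst (fst p) + a, snd p)) \<in> ((lebesgue \<Otimes>\<^sub>M borel) \<Otimes>\<^sub>M lborel) \<rightarrow>\<^sub>M (lebesgue \<Otimes>\<^sub>M borel)"
      by measurable
    from measurable_comp[OF this Suc] show ?thesis
      by (simp add: o_def case_prod_unfold)
  qed
  \<comment> \<open>The coupling is Borel in the frequency; the identity transfers this to the
    larger Lebesgue sigma-algebra.\<close>
  have "(\<lambda>x. x) \<in> lebesgue \<rightarrow>\<^sub>M (borel :: real measure)"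
    by (rule measurable_completion) simp
  then have [measurable]: "(\<lambda>p. fst (fst p)) \<in>
      ((lebesgue \<Otimes>\<^sub>M borel) \<Otimes>\<^sub>M lborel) \<rightarrow>\<^sub>M (borel :: real measure)"
    by (rule measurable_compose[rotated]) measurable
  have cp: "(\<lambda>p. coupling (fst (fst p) + a) (snd p))
      \<in> borel_measurable ((lebesgue \<Otimes>\<^sub>M borel) \<Otimes>\<^sub>M lborel)" for a
    unfolding coupling_def by measurable
  have [measurable]: "(\<lambda>p. rhs (picard f j) (snd p) (fst (fst p)))
      \<in> borel_measurable ((lebesgue \<Otimes>\<^sub>M borel) \<Otimes>\<^sub>M lborel)"
  proof -
    note [measurable] = shift[of 1, unfolded case_prod_unfold]
      shift[of "-1", unfolded case_prod_unfold add_uminus_conv_diff]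
      cp[of 1] cp[of "-1", unfolded add_uminus_conv_diff]
    show ?thesis
      unfolding rhs_def by measurable
  qed
  have "(\<lambda>p. indicator {0..snd (fst p)} (snd p) *\<^sub>R rhs (picard f j) (snd p) (fst (fst p)))
      \<in> borel_measurable ((lebesgue \<Otimes>\<^sub>M borel) \<Otimes>\<^sub>M lborel)"
    unfolding indicator_def atLeastAtMost_iff by measurable
  then have "(\<lambda>(x, t). LINT s:{0..t}|lborel. rhs (picard f j) s x) \<in> borel_measurable (lebesgue \<Otimes>\<^sub>M borel)"
    unfolding set_lebesgue_integral_def case_prod_unfold
    by (intro lborel.borel_measurable_lebesgue_integral) (simp add: case_prod_unfold)
  then show ?case by simp
qed

lemma picard_measurable:
  assumes "f \<in> borel_measurable lebesgue"
  shows "picard f j t \<in> borel_measurable lebesgue"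
  using measurable_compose[OF _ picard_measurable_pair[OF assms], of "\<lambda>x. (x, t)"] by simp

section \<open>Convergence of the iterates to any solution of exponential growth\<close>

lemma solution_derivative:
  assumes "solves_system c k f \<omega>" and "0 \<le> s"
  shows "((\<lambda>t. \<omega> t x) has_vector_derivative rhs \<omega> s x) (at s within {0..})"
proof -
  obtain D where D: "((\<lambda>t. \<omega> t x) has_vector_derivative D) (at s within {0..})"
    and "D + of_real (coupling (x + 1) s) * \<omega> s (x + 1) - of_real (coupling (x - 1) s) * \<omega> s (x - 1) = 0"
    using assms unfolding solves_system_def coupling_def by blast
  then have "D = rhs \<omega> s x"
    by (simp add: rhs_def algebra_simps)
  with D show ?thesis by simp
qed

text \<open>Each Duhamel step costs a factor \<open>2 R\<close> from the growth along the lattice, but the ordering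
  of the times gains \<open>1 / j!\<close>; so any exponential growth rate \<open>R\<close> is admissible.\<close>

lemma picard_tendsto:
  assumes sol: "solves_system c k f \<omega>" and "exp_growth \<omega>" and "0 \<le> t"
  shows "(\<lambda>j. picard f j t x) \<longlonglongrightarrow> \<omega> t x"
proof -
  obtain M R0 where MR0: "\<forall>s\<in>{0..t}. \<forall>n::int. cmod (\<omega> s (x + of_int n)) \<le> M * R0 ^ nat \<bar>n\<bar>"
    using \<open>exp_growth \<omega>\<close> \<open>0 \<le> t\<close> unfolding exp_growth_def by blast
  have "cmod (\<omega> t x) \<le> M"
    using MR0[rule_format, of t 0] \<open>0 \<le> t\<close> by simp
  then have M: "0 \<le> M"
    using norm_ge_zero[of "\<omega> t x"] by linarith
  \<comment> \<open>A rate of at least 1 makes the powers nonnegative and increasing in the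
    exponent, whatever the sign of \<open>R0\<close>.\<close>
  define R where "R = max 1 \<bar>R0\<bar>"
  have R: "1 \<le> R"
    by (simp add: R_def)
  have R0: "R0 ^ m \<le> R ^ m" for m
  proof -
    have "R0 ^ m \<le> \<bar>R0\<bar> ^ m"
      using abs_ge_self[of "R0 ^ m"] by (simp add: power_abs)
    also have "\<dots> \<le> R ^ m"
      by (intro power_mono) (auto simp: R_def)
    finally show ?thesis .
  qed
  \<comment> \<open>Two neighbours, each with coupling at most \<open>c / (2 * k\<^sup>2)\<close>
    and each costing a factor \<open>R\<close>.\<close>
  define K where "K = c * R / k\<^sup>2"
  have K: "0 \<le> K"
    using c_pos R by (simp add: K_def)
  define E where "E n = M * R ^ nat \<bar>n\<bar>" for n :: int
  have E_step: "E m \<le> R * E n" if "\<bar>m\<bar> \<le> \<bar>n\<bar> + 1" for m n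
  proof -
    have "R ^ nat \<bar>m\<bar> \<le> R ^ Suc (nat \<bar>n\<bar>)"
      using that by (intro power_increasing R) auto
    then have "M * R ^ nat \<bar>m\<bar> \<le> M * R ^ Suc (nat \<bar>n\<bar>)"
      using M by (rule mult_left_mono)
    then show ?thesis
      by (simp add: E_def mult_ac)
  qed
  \<comment> \<open>The induction runs over all lattice points and times at once, since the step at
    \<open>n\<close> uses the previous bound at \<open>n + 1\<close> and
    \<open>n - 1\<close>.\<close>
  have remainder: "cmod (\<omega> s (x + of_int n) - picard f j s (x + of_int n)) \<le> E n * (K * s) ^ j / fact j"
    if "0 \<le> s" "s \<le> t" for j s n
    using that
  proof (induction j arbitrary: s n)
    case 0
    then have "cmod (\<omega> s (x + of_int n)) \<le> M * R0 ^ nat \<bar>n\<bar>"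
      using MR0 by auto
    also have "\<dots> \<le> E n"
      unfolding E_def using M R0 by (intro mult_left_mono)
    finally show ?case by simp
  next
    case (Suc j)
    let ?y = "x + of_int n"
    let ?d = "\<lambda>s y. \<omega> s y - picard f j s y"
    let ?g = "\<lambda>s. E n * (K * s) ^ Suc j / fact (Suc j)"
    have "norm ((\<omega> s ?y - picard f (Suc j) s ?y) - (\<omega> 0 ?y - picard f (Suc j) 0 ?y)) \<le> ?g s - ?g 0"
    proof (rule norm_increment_le[where f' = "\<lambda>s. rhs ?d s ?y" and g' = "\<lambda>s. K * (E n * (K * s) ^ j / fact j)"])
      fix u :: real
      assume u: "0 \<le> u"
      have "rhs ?d u ?y = rhs \<omega> u ?y - rhs (picard f j) u ?y"
        by (simp add: rhs_def algebra_simps)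
      then show "((\<lambda>s. \<omega> s ?y - picard f (Suc j) s ?y) has_vector_derivative rhs ?d u ?y) (at u within {0..})"
        using has_vector_derivative_diff[OF solution_derivative[OF sol u] picard_derivative[OF u]] by simp
      have "((\<lambda>s. E n * (K * s) ^ Suc j / fact (Suc j)) has_real_derivative
          E n * (real (Suc j) * (K * u) ^ j * K) / fact (Suc j)) (at u within {0..})"
        by (auto intro!: derivative_eq_intros simp del: power_Suc fact_Suc)
      moreover have "E n * (real (Suc j) * (K * u) ^ j * K) / fact (Suc j) = K * (E n * (K * u) ^ j / fact j)"
        by (simp add: divide_simps del: of_nat_Suc)
      ultimately show "(?g has_real_derivative K * (E n * (K * u) ^ j / fact j)) (at u within {0..})"
        by (simp only:)
      assume "u \<le> s"
      then have ut: "u \<le> t"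
        using Suc.prems by simp
      let ?a = "R * E n * (K * u) ^ j / fact j"
      have step: "cmod (?d u (x + of_int m)) \<le> ?a" if "\<bar>m\<bar> \<le> \<bar>n\<bar> + 1" for m
      proof -
        have "E m * (K * u) ^ j / fact j \<le> ?a"
          using E_step[OF that] K u by (intro divide_right_mono mult_right_mono) auto
        with Suc.IH[OF u ut, of m] show ?thesis by linarith
      qed
      have a: "0 \<le> ?a"
        using R M K u by (auto simp: E_def)
      have "cmod (rhs ?d u ?y) \<le> coupling (?y + 1) u * ?a + coupling (?y - 1) u * ?a"
        using step[of "n + 1"] step[of "n - 1"] by (intro norm_rhs_le) (auto simp: algebra_simps)
      also have "\<dots> \<le> c / (2 * k\<^sup>2) * ?a + c / (2 * k\<^sup>2) * ?a"
        using a by (intro add_mono mult_right_mono coupling_le)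
      also have "\<dots> = K * (E n * (K * u) ^ j / fact j)"
      proof -
        have "c / (2 * k\<^sup>2) * (R * e * p / q) + c / (2 * k\<^sup>2) * (R * e * p / q) = c * R / k\<^sup>2 * (e * p / q)"
          for e p q :: real
          by (simp add: mult_ac)
        then show ?thesis
          unfolding K_def[symmetric] .
      qed
      finally show "norm (rhs ?d u ?y) \<le> K * (E n * (K * u) ^ j / fact j)" .
    qed (use Suc.prems in auto)
    moreover have "\<omega> 0 ?y = f ?y"
      using sol by (simp add: solves_system_def)
    ultimately show ?case
      using picard_at_0[of f j ?y] by simp
  qed
  \<comment> \<open>The terms of the exponential series tend to 0.\<close>
  have "(\<lambda>j. E 0 * ((K * t) ^ j / fact j)) \<longlonglongrightarrow> E 0 * 0"
    using summable_LIMSEQ_zero[OF summable_exp[of "K * t"]]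
    by (intro tendsto_mult tendsto_const) (simp add: divide_inverse mult.commute)
  then have lim: "(\<lambda>j. E 0 * (K * t) ^ j / fact j) \<longlonglongrightarrow> 0"
    by (simp only: times_divide_eq_right mult_zero_right)
  have "cmod (\<omega> t x - picard f j t x) \<le> E 0 * (K * t) ^ j / fact j" for j
    using remainder[where s = t and n = 0 and j = j] \<open>0 \<le> t\<close> by (simp only: of_int_0 add_0_right order_refl)
  then have "(\<lambda>j. \<omega> t x - picard f j t x) \<longlonglongrightarrow> 0"
    by (intro Lim_null_comparison[OF _ lim] always_eventually allI)
  then have "(\<lambda>j. \<omega> t x - (\<omega> t x - picard f j t x)) \<longlonglongrightarrow> \<omega> t x - 0"
    by (intro tendsto_intros)
  then show ?thesis by simp
qed

text \<open>The system only concerns regularity in time at each frequency. Measurability in the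
  frequency is inherited from the data through the pointwise limit of the iterates.\<close>

lemma solution_measurable:
  assumes "solves_system c k f \<omega>" "exp_growth \<omega>" "0 \<le> t" "f \<in> borel_measurable lebesgue"
  shows "\<omega> t \<in> borel_measurable lebesgue"
  using picard_measurable[OF assms(4)] picard_tendsto[OF assms(1-3)]
  by (rule borel_measurable_LIMSEQ_metric)

text \<open>The majorant reproduces itself: if \<open>2 F\<close> bounds one iterate, the next one deviates from the
  data by at most \<open>\<rho> / 4 * (2 F (n + 1) + 2 F (n - 1)) \<le> F n\<close>, hence is again bounded by \<open>2 F\<close>.\<close>

lemma picard_bound_uniform:
  fixes F :: "int \<Rightarrow> real"
  assumes \<rho>: "2 * pi * c / \<bar>k\<bar> \<le> \<rho>"
    and f: "\<And>n. cmod (f (x + of_int n)) \<le> F n"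
    and up: "\<And>n. \<rho> * F (n + 1) \<le> F n" and down: "\<And>n. \<rho> * F (n - 1) \<le> F n"
    and "0 \<le> t"
  shows "cmod (picard f j t (x + of_int n) - f (x + of_int n)) \<le> F n"
  using \<open>0 \<le> t\<close>
proof (induction j arbitrary: t n)
  case 0
  then show ?case using f by simp
next
  case (Suc j)
  let ?y = "x + of_int n"
  define A where "A y s = c / (2 * \<bar>k\<bar>) * arctan ((s - y) / \<bar>k\<bar>)" for y s
  have F: "0 \<le> F m" for m
    using f[of m] norm_ge_zero order_trans by blast
  \<comment> \<open>The increment of the arctangent stays below \<open>pi\<close> however large
    \<open>t\<close> is, and \<open>c * pi / (2 * \<bar>k\<bar>)\<close> is a quarter of
    \<open>2 * pi * c / \<bar>k\<bar>\<close>.\<close>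
  have A: "A y t - A y 0 \<le> \<rho> / 4" for y
  proof -
    have "A y t - A y 0 = c / (2 * \<bar>k\<bar>) * (arctan ((t - y) / \<bar>k\<bar>) - arctan ((0 - y) / \<bar>k\<bar>))"
      by (simp only: A_def right_diff_distrib)
    also have "\<dots> \<le> c / (2 * \<bar>k\<bar>) * pi"
      using arctan_ubound[of "(t - y) / \<bar>k\<bar>"] arctan_lbound[of "(0 - y) / \<bar>k\<bar>"] c_pos
      by (intro mult_left_mono) auto
    also have "\<dots> = (2 * pi * c / \<bar>k\<bar>) / 4"
      by simp
    also have "\<dots> \<le> \<rho> / 4"
      using \<rho> by (rule divide_right_mono) simp
    finally show ?thesis .
  qed
  have iter: "cmod (picard f j s (x + of_int m)) \<le> 2 * F m" if "0 \<le> s" for s m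
    using Suc.IH[OF that, of m] f[of m]
      norm_triangle_sub[of "picard f j s (x + of_int m)" "f (x + of_int m)"] by linarith
  let ?g = "\<lambda>s. A (?y + 1) s * (2 * F (n + 1)) + A (?y - 1) s * (2 * F (n - 1))"
  have "norm (picard f (Suc j) t ?y - picard f (Suc j) 0 ?y) \<le> ?g t - ?g 0"
  proof (rule norm_increment_le[where f' = "\<lambda>s. rhs (picard f j) s ?y" and
        g' = "\<lambda>s. coupling (?y + 1) s * (2 * F (n + 1)) + coupling (?y - 1) s * (2 * F (n - 1))"])
    fix s :: real
    assume s: "0 \<le> s"
    show "((\<lambda>s. picard f (Suc j) s ?y) has_vector_derivative rhs (picard f j) s ?y) (at s within {0..})"
      using s by (rule picard_derivative)
    show "(?g has_real_derivative coupling (?y + 1) s * (2 * F (n + 1)) + coupling (?y - 1) s * (2 * F (n - 1)))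
        (at s within {0..})"
      unfolding A_def by (intro DERIV_add DERIV_cmult_right coupling_antiderivative)
    show "norm (rhs (picard f j) s ?y)
        \<le> coupling (?y + 1) s * (2 * F (n + 1)) + coupling (?y - 1) s * (2 * F (n - 1))"
      using iter[OF s, of "n + 1"] iter[OF s, of "n - 1"]
      by (intro norm_rhs_le) (auto simp: algebra_simps)
  qed (use Suc.prems in auto)
  also have "\<dots> = (A (?y + 1) t - A (?y + 1) 0) * (2 * F (n + 1)) + (A (?y - 1) t - A (?y - 1) 0) * (2 * F (n - 1))"
    by (simp add: algebra_simps)
  also have "\<dots> \<le> \<rho> / 4 * (2 * F (n + 1)) + \<rho> / 4 * (2 * F (n - 1))"
    using F by (intro add_mono mult_right_mono A) auto
  also have "\<dots> \<le> F n"
    using up[of n] down[of n] by simp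
  finally show ?case
    by (simp only: picard_at_0)
qed

text \<open>A Gronwall argument for arbitrary \<open>r\<close>. Each of the two neighbours is at
  most \<open>F n / r\<close> times the exponential and has coupling at most
  \<open>c / (2 * k\<^sup>2)\<close>, which gives the rate
  \<open>c / (k\<^sup>2 * r)\<close>.\<close>

lemma picard_bound_exponential:
  fixes F :: "int \<Rightarrow> real"
  assumes r: "0 < r"
    and f: "\<And>n. cmod (f (x + of_int n)) \<le> F n"
    and up: "\<And>n. r * F (n + 1) \<le> F n" and down: "\<And>n. r * F (n - 1) \<le> F n"
    and "0 \<le> t"
  shows "cmod (picard f j t (x + of_int n)) \<le> exp (c / (k\<^sup>2 * r) * t) * F n"
  using \<open>0 \<le> t\<close>
proof (induction j arbitrary: t n)
  case 0
  have "0 \<le> F n"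
    using f[of n] norm_ge_zero order_trans by blast
  then show ?case by simp
next
  case (Suc j)
  let ?y = "x + of_int n"
  define K where "K = c / (k\<^sup>2 * r)"
  let ?g = "\<lambda>s. exp (K * s) * F n"
  have "norm (picard f (Suc j) t ?y - picard f (Suc j) 0 ?y) \<le> ?g t - ?g 0"
  proof (rule norm_increment_le[where f' = "\<lambda>s. rhs (picard f j) s ?y" and g' = "\<lambda>s. K * exp (K * s) * F n"])
    fix s :: real
    assume s: "0 \<le> s"
    show "((\<lambda>s. picard f (Suc j) s ?y) has_vector_derivative rhs (picard f j) s ?y) (at s within {0..})"
      using s by (rule picard_derivative)
    show "(?g has_real_derivative K * exp (K * s) * F n) (at s within {0..})"
      by (auto intro!: derivative_eq_intros)
    let ?a = "exp (K * s) * (F n / r)"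
    have iter: "cmod (picard f j s (x + of_int m)) \<le> ?a" if "r * F m \<le> F n" for m
    proof -
      have "cmod (picard f j s (x + of_int m)) \<le> exp (K * s) * F m"
        using Suc.IH[OF s] by (simp add: K_def)
      also have "\<dots> \<le> ?a"
        using that r by (intro mult_left_mono) (auto simp: field_simps)
      finally show ?thesis .
    qed
    have a: "0 \<le> ?a"
      using iter[OF up[of n]] norm_ge_zero order_trans by blast
    have "norm (rhs (picard f j) s ?y) \<le> coupling (?y + 1) s * ?a + coupling (?y - 1) s * ?a"
      using iter[OF up[of n]] iter[OF down[of n]] by (intro norm_rhs_le) (auto simp: algebra_simps)
    also have "\<dots> \<le> c / (2 * k\<^sup>2) * ?a + c / (2 * k\<^sup>2) * ?a"
      using a by (intro add_mono mult_right_mono coupling_le)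
    also have "\<dots> = K * exp (K * s) * F n"
      using r by (simp add: K_def field_simps)
    finally show "norm (rhs (picard f j) s ?y) \<le> K * exp (K * s) * F n" .
  qed (use Suc.prems in auto)
  \<comment> \<open>The subtracted \<open>F n\<close>, the comparison function at time 0, exactly
    pays for the data.\<close>
  then have "cmod (picard f (Suc j) t ?y - f ?y) \<le> exp (K * t) * F n - F n"
    unfolding picard_at_0 by simp
  with f[of n] norm_triangle_sub[of "picard f (Suc j) t ?y" "f ?y"] show ?case
    unfolding K_def by linarith
qed

text \<open>The bound on the iterates passes to the limit. Since \<open>x\<close> is an arbitrary
  base point of its lattice, the value at \<open>n = 0\<close> suffices; the same holds for the
  exponential version.\<close>

lemma solution_bound_uniform:
  fixes F :: "int \<Rightarrow> real"
  assumes "solves_system c k f \<omega>" "exp_growth \<omega>" "0 \<le> t" and "2 * pi * c / \<bar>k\<bar> \<le> \<rho>"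
    and "\<And>n. cmod (f (x + of_int n)) \<le> F n"
    and "\<And>n. \<rho> * F (n + 1) \<le> F n" and "\<And>n. \<rho> * F (n - 1) \<le> F n"
  shows "cmod (\<omega> t x - f x) \<le> F 0"
proof (rule Lim_bounded)
  show "(\<lambda>j. cmod (picard f j t x - f x)) \<longlonglongrightarrow> cmod (\<omega> t x - f x)"
    by (intro tendsto_intros picard_tendsto assms)
  show "\<forall>j\<ge>0. cmod (picard f j t x - f x) \<le> F 0"
    using picard_bound_uniform[where n = 0 and F = F and f = f and x = x, OF assms(4-7,3)] by simp
qed

lemma solution_bound_exponential:
  fixes F :: "int \<Rightarrow> real"
  assumes "solves_system c k f \<omega>" "exp_growth \<omega>" "0 \<le> t" and "0 < r"
    and "\<And>n. cmod (f (x + of_int n)) \<le> F n"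
    and "\<And>n. r * F (n + 1) \<le> F n" and "\<And>n. r * F (n - 1) \<le> F n"
  shows "cmod (\<omega> t x) \<le> exp (c / (k\<^sup>2 * r) * t) * F 0"
proof (rule Lim_bounded)
  show "(\<lambda>j. cmod (picard f j t x)) \<longlonglongrightarrow> cmod (\<omega> t x)"
    by (intro tendsto_intros picard_tendsto assms)
  show "\<forall>j\<ge>0. cmod (picard f j t x) \<le> exp (c / (k\<^sup>2 * r) * t) * F 0"
    using picard_bound_exponential[where n = 0 and F = F and f = f and x = x, OF assms(4-7,3)] by simp
qed

end

section \<open>Lattice sums\<close>

text \<open>The convolution of \<open>freq_conv\<close>, indexed by the displacement
  \<open>n\<close> and written as an integral over counting measure, so that Tonelli and reindexing
  by bijections apply.\<close>

definition lattice_sum :: "real \<Rightarrow> (real \<Rightarrow> real) \<Rightarrow> real \<Rightarrow> ennreal" where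
  "lattice_sum q f x =
     (\<integral>\<^sup>+n. ennreal (q powr \<bar>real_of_int n\<bar> * f (x + real_of_int n)) \<partial>count_space (UNIV :: int set))"

text \<open>Along an enumeration of the integers the integral is a supremum of finite partial sums,
  and \<open>infsum\<close> is the supremum over all finite sums.\<close>

lemma nn_integral_count_space_int_le_infsum:
  fixes g :: "int \<Rightarrow> ennreal"
  shows "(\<integral>\<^sup>+n. g n \<partial>count_space UNIV) \<le> infsum g UNIV"
proof -
  have "(\<integral>\<^sup>+n. g n \<partial>count_space UNIV) = (\<Sum>i. g (int_decode i))"
    by (simp add: nn_integral_bij_count_space[OF bij_int_decode, symmetric] nn_integral_count_space_nat)
  also have "\<dots> = (SUP n. \<Sum>i<n. g (int_decode i))"
    by (rule suminf_eq_SUP)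
  also have "\<dots> \<le> infsum g UNIV"
  proof (rule SUP_least)
    fix n
    have "(\<Sum>i<n. g (int_decode i)) = sum g (int_decode ` {..<n})"
      by (simp add: sum.reindex inj_int_decode inj_on_subset[OF inj_int_decode])
    also have "\<dots> \<le> (SUP F\<in>{F. finite F \<and> F \<subseteq> UNIV}. sum g F)"
      by (rule SUP_upper) auto
    also have "\<dots> = infsum g UNIV"
      by (rule nonneg_infsum_complete[symmetric]) auto
    finally show "(\<Sum>i<n. g (int_decode i)) \<le> infsum g UNIV" .
  qed
  finally show ?thesis .
qed

lemma lattice_sum_le_freq_conv: "lattice_sum q f x \<le> freq_conv (\<lambda>m. q powr \<bar>m\<bar>) f x"
proof -
  have "freq_conv (\<lambda>m. q powr \<bar>m\<bar>) f x =
      (\<Sum>\<^sub>\<infinity>n::int. ennreal (q powr \<bar>real_of_int n\<bar> * f (x + real_of_int n)))"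
    unfolding freq_conv_def by (subst infsum_reindex) (auto simp: inj_on_def o_def)
  then show ?thesis
    using nn_integral_count_space_int_le_infsum by (simp add: lattice_sum_def)
qed

lemma lattice_sum_ge: "ennreal (f x) \<le> lattice_sum q f x" if "0 < q"
  using nn_integral_ge_point[of "0::int" UNIV "\<lambda>n. ennreal (q powr \<bar>real_of_int n\<bar> * f (x + real_of_int n))"] that
  by (simp add: lattice_sum_def)

text \<open>After reindexing by \<open>m = n + d\<close> this is the triangle inequality for
  \<open>\<bar>m\<bar>\<close>, as powers of \<open>q \<le> 1\<close> decrease in the exponent. The
  case \<open>\<bar>d\<bar> = 1\<close> is the majorant property.\<close>

lemma lattice_sum_translate:
  assumes q: "0 < q" "q \<le> 1" and f: "\<And>y. 0 \<le> f y"
  shows "ennreal (q powr \<bar>real_of_int d\<bar>) * lattice_sum q f (x + real_of_int d) \<le> lattice_sum q f x"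
proof -
  have "bij (\<lambda>m::int. m - d)"
    by (rule bij_betw_byWitness[where f' = "\<lambda>m. m + d"]) auto
  from nn_integral_bij_count_space[OF this,
      of "\<lambda>n. ennreal (q powr \<bar>real_of_int n\<bar> * f (x + real_of_int d + real_of_int n))"]
  have "lattice_sum q f (x + real_of_int d) =
      (\<integral>\<^sup>+m. ennreal (q powr \<bar>real_of_int (m - d)\<bar> * f (x + real_of_int m)) \<partial>count_space UNIV)"
    by (simp add: lattice_sum_def)
  then have "ennreal (q powr \<bar>real_of_int d\<bar>) * lattice_sum q f (x + real_of_int d) =
      (\<integral>\<^sup>+m. ennreal (q powr \<bar>real_of_int d\<bar>) *
        ennreal (q powr \<bar>real_of_int (m - d)\<bar> * f (x + real_of_int m)) \<partial>count_space UNIV)"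
    by (simp add: nn_integral_cmult)
  also have "\<dots> \<le> lattice_sum q f x"
    unfolding lattice_sum_def
  proof (rule nn_integral_mono)
    fix m :: int
    have "q powr \<bar>real_of_int d\<bar> * q powr \<bar>real_of_int (m - d)\<bar> \<le> q powr \<bar>real_of_int m\<bar>"
      unfolding powr_add[symmetric] using q by (intro powr_mono') auto
    then have "q powr \<bar>real_of_int d\<bar> * (q powr \<bar>real_of_int (m - d)\<bar> * f (x + real_of_int m))
        \<le> q powr \<bar>real_of_int m\<bar> * f (x + real_of_int m)"
      using f by (simp add: mult_right_mono mult.assoc[symmetric])
    then show "ennreal (q powr \<bar>real_of_int d\<bar>) * ennreal (q powr \<bar>real_of_int (m - d)\<bar> * f (x + real_of_int m))
        \<le> ennreal (q powr \<bar>real_of_int m\<bar> * f (x + real_of_int m))"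
      using f by (simp add: ennreal_mult[symmetric] ennreal_leI)
  qed
  finally show ?thesis .
qed

lemma lattice_sum_majorant:
  assumes q: "0 < q" "q \<le> 1" and f: "\<And>y. 0 \<le> f y" and fin: "lattice_sum q f x \<noteq> \<infinity>"
  obtains F :: "int \<Rightarrow> real" where "ennreal (F 0) = lattice_sum q f x"
    and "\<And>n. f (x + of_int n) \<le> F n" and "\<And>n. q * F (n + 1) \<le> F n" and "\<And>n. q * F (n - 1) \<le> F n"
proof
  define F where "F n = enn2real (lattice_sum q f (x + of_int n))" for n :: int
  \<comment> \<open>Finiteness at \<open>x\<close> spreads along the lattice because the translation
    factor is positive; hence the majorant can be real valued.\<close>
  have "lattice_sum q f (x + of_int n) \<noteq> \<infinity>" for n
  proof
    assume "lattice_sum q f (x + of_int n) = \<infinity>"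
    then have "ennreal (q powr \<bar>real_of_int n\<bar>) * lattice_sum q f (x + of_int n) = \<infinity>"
      using q by (simp add: ennreal_mult_top)
    with lattice_sum_translate[where f = f and d = n and x = x, OF q f] fin show False
      by (simp add: top_unique)
  qed
  then have F: "ennreal (F n) = lattice_sum q f (x + of_int n)" for n
    by (simp add: F_def less_top)
  have F_nonneg: "0 \<le> F n" for n
    by (simp add: F_def)
  show "ennreal (F 0) = lattice_sum q f x"
    using F[of 0] by simp
  show "f (x + of_int n) \<le> F n" for n
    using lattice_sum_ge[OF q(1), where f = f and x = "x + of_int n"] F_nonneg unfolding F[symmetric] by simp
  have step: "q * F (n + d) \<le> F n" if "\<bar>real_of_int d\<bar> = 1" for n d
  proof -
    have "x + of_int n + of_int d = x + of_int (n + d)"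
      by simp
    with lattice_sum_translate[where f = f and d = d and x = "x + of_int n", OF q f] that q(1)
    have "ennreal q * ennreal (F (n + d)) \<le> ennreal (F n)"
      unfolding F by simp
    then show ?thesis
      using F_nonneg q by (simp add: ennreal_mult[symmetric])
  qed
  show "q * F (n + 1) \<le> F n" "q * F (n - 1) \<le> F n" for n
    using step[of 1 n] step[of "-1" n] by simp_all
qed

text \<open>Taking roots turns the rate \<open>r\<^sup>2\<close> for the squares into the rate
  \<open>r\<close>. The square of this majorant is linear in \<open>(norm (f y))\<^sup>2\<close>, so
  weighted square integrals of it can be treated by Tonelli.\<close>

lemma lattice_sum_sqrt_majorant:
  assumes r: "0 < r" "r \<le> 1" and fin: "lattice_sum (r\<^sup>2) (\<lambda>y. (norm (f y))\<^sup>2) x \<noteq> \<infinity>"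
  obtains G :: "int \<Rightarrow> real" where "ennreal ((G 0)\<^sup>2) = lattice_sum (r\<^sup>2) (\<lambda>y. (norm (f y))\<^sup>2) x"
    and "0 \<le> G 0"
    and "\<And>n. norm (f (x + of_int n)) \<le> G n" and "\<And>n. r * G (n + 1) \<le> G n" and "\<And>n. r * G (n - 1) \<le> G n"
proof -
  obtain F :: "int \<Rightarrow> real" where F: "ennreal (F 0) = lattice_sum (r\<^sup>2) (\<lambda>y. (norm (f y))\<^sup>2) x"
    "\<And>n. (norm (f (x + of_int n)))\<^sup>2 \<le> F n" "\<And>n. r\<^sup>2 * F (n + 1) \<le> F n" "\<And>n. r\<^sup>2 * F (n - 1) \<le> F n"
    using lattice_sum_majorant[OF _ _ _ fin] r by (auto simp: power_le_one)
  have F_nonneg: "0 \<le> F n" for n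
    using F(2)[of n] zero_le_power2 order_trans by blast
  show thesis
  proof
    show "ennreal ((sqrt (F 0))\<^sup>2) = lattice_sum (r\<^sup>2) (\<lambda>y. (norm (f y))\<^sup>2) x"
      using F(1) F_nonneg by simp
    show "0 \<le> sqrt (F 0)"
      using F_nonneg by simp
    show "norm (f (x + of_int n)) \<le> sqrt (F n)" for n
      using F(2) by (rule real_le_rsqrt)
    have *: "r * sqrt (F m) = sqrt (r\<^sup>2 * F m)" for m
      using r by (simp add: real_sqrt_mult)
    show "r * sqrt (F (n + 1)) \<le> sqrt (F n)" "r * sqrt (F (n - 1)) \<le> sqrt (F n)" for n
      unfolding * using F(3,4) by (auto intro: real_sqrt_le_mono)
  qed
qed

section \<open>From pointwise lattice bounds to weighted square integrals\<close>

text \<open>Tonelli and a shift of the integration variable by \<open>n\<close> move the translation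
  from \<open>h\<close> to the weight, where it costs the factor \<open>W n\<close>.\<close>

lemma weighted_lattice_sum_le:
  fixes w h :: "real \<Rightarrow> real" and W :: "int \<Rightarrow> real"
  assumes w [measurable]: "w \<in> borel_measurable lebesgue" and h [measurable]: "h \<in> borel_measurable lebesgue"
    and nonneg: "\<And>y. 0 \<le> w y" "\<And>y. 0 \<le> h y" and W: "\<And>n y. w (y - of_int n) \<le> W n * w y"
    and W_nonneg: "\<And>n. 0 \<le> W n"
  shows "(\<integral>\<^sup>+x. ennreal (w x) * lattice_sum q h x \<partial>lebesgue)
    \<le> (\<integral>\<^sup>+n. ennreal (q powr \<bar>real_of_int n\<bar> * W n) \<partial>count_space UNIV) * (\<integral>\<^sup>+x. ennreal (w x * h x) \<partial>lebesgue)"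
proof -
  have shift [measurable]: "(\<lambda>x. h (x + a)) \<in> borel_measurable lebesgue"
      "(\<lambda>x. w (x - a)) \<in> borel_measurable lebesgue" for a
    using measurable_compose[OF lebesgue_translation_measurable h, of a]
      measurable_compose[OF lebesgue_translation_measurable w, of "- a"]
    by simp_all
  have "(\<integral>\<^sup>+x. ennreal (w x) * lattice_sum q h x \<partial>lebesgue) =
      (\<integral>\<^sup>+x. \<integral>\<^sup>+n. ennreal (w x * (q powr \<bar>real_of_int n\<bar> * h (x + real_of_int n))) \<partial>count_space UNIV \<partial>lebesgue)"
    unfolding lattice_sum_def using nonneg
    by (simp add: nn_integral_cmult[symmetric] ennreal_mult)
  also have "\<dots> = (\<integral>\<^sup>+n. \<integral>\<^sup>+x. ennreal (w x * (q powr \<bar>real_of_int n\<bar> * h (x + real_of_int n))) \<partial>lebesgue \<partial>count_space UNIV)"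
    by (intro nn_integral_count_space_nn_integral) (auto intro!: borel_measurable_times)
  also have "\<dots> \<le> (\<integral>\<^sup>+n. ennreal (q powr \<bar>real_of_int n\<bar> * W n) * (\<integral>\<^sup>+x. ennreal (w x * h x) \<partial>lebesgue) \<partial>count_space UNIV)"
  proof (rule nn_integral_mono)
    fix n :: int
    let ?g = "\<lambda>x. ennreal (w (x - of_int n) * (q powr \<bar>real_of_int n\<bar> * h x))"
    have "(\<integral>\<^sup>+x. ennreal (w x * (q powr \<bar>real_of_int n\<bar> * h (x + real_of_int n))) \<partial>lebesgue) = (\<integral>\<^sup>+x. ?g x \<partial>lebesgue)"
      by (subst nn_integral_real_affine_lebesgue[of ?g 1 "of_int n"]) (simp_all add: add.commute)
    also have "\<dots> \<le> (\<integral>\<^sup>+x. ennreal (q powr \<bar>real_of_int n\<bar> * W n) * ennreal (w x * h x) \<partial>lebesgue)"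
    proof (rule nn_integral_mono)
      fix x
      have "w (x - of_int n) * (q powr \<bar>real_of_int n\<bar> * h x) \<le> W n * w x * (q powr \<bar>real_of_int n\<bar> * h x)"
        using W nonneg by (intro mult_right_mono) auto
      then show "?g x \<le> ennreal (q powr \<bar>real_of_int n\<bar> * W n) * ennreal (w x * h x)"
        using nonneg W_nonneg by (simp add: ennreal_mult[symmetric] ennreal_leI mult_ac)
    qed
    also have "\<dots> = ennreal (q powr \<bar>real_of_int n\<bar> * W n) * (\<integral>\<^sup>+x. ennreal (w x * h x) \<partial>lebesgue)"
      by (rule nn_integral_cmult) measurable
    finally show "(\<integral>\<^sup>+x. ennreal (w x * (q powr \<bar>real_of_int n\<bar> * h (x + real_of_int n))) \<partial>lebesgue)
        \<le> ennreal (q powr \<bar>real_of_int n\<bar> * W n) * (\<integral>\<^sup>+x. ennreal (w x * h x) \<partial>lebesgue)" .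
  qed
  also have "\<dots> = (\<integral>\<^sup>+n. ennreal (q powr \<bar>real_of_int n\<bar> * W n) \<partial>count_space UNIV) * (\<integral>\<^sup>+x. ennreal (w x * h x) \<partial>lebesgue)"
    by (rule nn_integral_multc) simp
  finally show ?thesis .
qed

lemma weighted_integral_le:
  fixes f g :: "real \<Rightarrow> complex" and w :: "real \<Rightarrow> real" and W :: "int \<Rightarrow> real"
  assumes g [measurable]: "g \<in> borel_measurable lebesgue" and f [measurable]: "f \<in> borel_measurable lebesgue"
    and w [measurable]: "w \<in> borel_measurable lebesgue" and w_nonneg: "\<And>y. 0 \<le> w y"
    and W: "\<And>n y. w (y - of_int n) \<le> W n * w y" and W_nonneg: "\<And>n. 0 \<le> W n"
    and S: "(\<integral>\<^sup>+n. ennreal (q powr \<bar>real_of_int n\<bar> * W n) \<partial>count_space UNIV) = ennreal S" "0 \<le> S"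
    and bound: "\<And>x. ennreal ((cmod (g x))\<^sup>2) \<le> ennreal B * lattice_sum q (\<lambda>y. (cmod (f y))\<^sup>2) x" "0 \<le> B"
    and int: "integrable lebesgue (\<lambda>x. w x * (cmod (f x))\<^sup>2)"
  shows "integrable lebesgue (\<lambda>x. w x * (cmod (g x))\<^sup>2)"
    and "(LINT x|lebesgue. w x * (cmod (g x))\<^sup>2) \<le> B * S * (LINT x|lebesgue. w x * (cmod (f x))\<^sup>2)"
proof -
  let ?I = "LINT x|lebesgue. w x * (cmod (f x))\<^sup>2"
  have I: "(\<integral>\<^sup>+x. ennreal (w x * (cmod (f x))\<^sup>2) \<partial>lebesgue) = ennreal ?I" "0 \<le> ?I"
    using w_nonneg by (auto intro!: nn_integral_eq_integral int)
  have "(\<integral>\<^sup>+x. ennreal (w x * (cmod (g x))\<^sup>2) \<partial>lebesgue)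
      \<le> (\<integral>\<^sup>+x. ennreal (B * w x) * lattice_sum q (\<lambda>y. (cmod (f y))\<^sup>2) x \<partial>lebesgue)"
  proof (rule nn_integral_mono)
    fix x
    have "ennreal (w x) * ennreal ((cmod (g x))\<^sup>2) \<le> ennreal (w x) * (ennreal B * lattice_sum q (\<lambda>y. (cmod (f y))\<^sup>2) x)"
      by (intro mult_left_mono bound) simp
    then show "ennreal (w x * (cmod (g x))\<^sup>2) \<le> ennreal (B * w x) * lattice_sum q (\<lambda>y. (cmod (f y))\<^sup>2) x"
      using w_nonneg bound(2) by (simp add: ennreal_mult mult_ac)
  qed
  \<comment> \<open>The constant \<open>B\<close> is absorbed into the weight: \<open>B * w\<close>
    obeys the same translation inequality as \<open>w\<close>.\<close>
  also have "\<dots> \<le> ennreal S * (\<integral>\<^sup>+x. ennreal (B * w x * (cmod (f x))\<^sup>2) \<partial>lebesgue)"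
    unfolding S(1)[symmetric] using w_nonneg bound(2) W W_nonneg
    by (intro weighted_lattice_sum_le) (auto simp: mult.left_commute[of _ B] intro: mult_left_mono)
  also have "(\<integral>\<^sup>+x. ennreal (B * w x * (cmod (f x))\<^sup>2) \<partial>lebesgue) = ennreal (B * ?I)"
    using bound(2) w_nonneg I by (simp add: ennreal_mult mult.assoc nn_integral_cmult)
  also have "ennreal S * ennreal (B * ?I) = ennreal (B * S * ?I)"
    using S(2) bound(2) I(2) by (simp add: ennreal_mult[symmetric] mult_ac)
  finally have le: "(\<integral>\<^sup>+x. ennreal (w x * (cmod (g x))\<^sup>2) \<partial>lebesgue) \<le> ennreal (B * S * ?I)" .
  show int': "integrable lebesgue (\<lambda>x. w x * (cmod (g x))\<^sup>2)"
  proof (rule integrableI_nonneg)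
    show "(\<integral>\<^sup>+x. ennreal (w x * (cmod (g x))\<^sup>2) \<partial>lebesgue) < \<infinity>"
      using le by (rule le_less_trans) simp
  qed (use w_nonneg in auto)
  then have "ennreal (LINT x|lebesgue. w x * (cmod (g x))\<^sup>2) = (\<integral>\<^sup>+x. ennreal (w x * (cmod (g x))\<^sup>2) \<partial>lebesgue)"
    using w_nonneg by (intro nn_integral_eq_integral[symmetric]) auto
  with le have "ennreal (LINT x|lebesgue. w x * (cmod (g x))\<^sup>2) \<le> ennreal (B * S * ?I)"
    by (simp only:)
  then show "(LINT x|lebesgue. w x * (cmod (g x))\<^sup>2) \<le> B * S * ?I"
    using S(2) bound(2) I(2) by (subst (asm) ennreal_le_iff) auto
qed

lemma nn_integral_count_space_int_finite:
  fixes h :: "nat \<Rightarrow> real"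
  assumes "summable h" and "\<And>n. 0 \<le> h n"
  shows "(\<integral>\<^sup>+n. ennreal (h (nat \<bar>n\<bar>)) \<partial>count_space (UNIV :: int set)) < \<infinity>"
proof -
  have fin: "(\<integral>\<^sup>+n. ennreal (h n) \<partial>count_space UNIV) < \<infinity>"
    using assms by (simp add: nn_integral_count_space_nat suminf_ennreal2)
  have half: "(\<integral>\<^sup>+n. ennreal (h (nat \<bar>n\<bar>)) * indicator A n \<partial>count_space UNIV) < \<infinity>"
    if "bij_betw f UNIV A" "\<And>m. nat \<bar>f m\<bar> = m" for f :: "nat \<Rightarrow> int" and A
  proof -
    have "(\<integral>\<^sup>+n. ennreal (h (nat \<bar>n\<bar>)) \<partial>count_space A) < \<infinity>"
      using nn_integral_bij_count_space[OF that(1), of "\<lambda>n. ennreal (h (nat \<bar>n\<bar>))"] fin that(2) by simp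
    moreover have "(\<integral>\<^sup>+n. ennreal (h (nat \<bar>n\<bar>)) * indicator A n \<partial>count_space UNIV)
        = (\<integral>\<^sup>+n. ennreal (h (nat \<bar>n\<bar>)) \<partial>count_space A)"
      by (simp add: nn_integral_restrict_space[symmetric] restrict_count_space)
    ultimately show ?thesis by simp
  qed
  \<comment> \<open>The two half-lines overlap in 0, which is counted twice; an upper bound
    tolerates this.\<close>
  have "(\<integral>\<^sup>+n. ennreal (h (nat \<bar>n\<bar>)) \<partial>count_space (UNIV :: int set)) \<le>
      (\<integral>\<^sup>+n. ennreal (h (nat \<bar>n\<bar>)) * indicator {0..} n + ennreal (h (nat \<bar>n\<bar>)) * indicator {..0} n \<partial>count_space (UNIV :: int set))"
    by (intro nn_integral_mono) (auto split: split_indicator)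
  also have "\<dots> = (\<integral>\<^sup>+n. ennreal (h (nat \<bar>n\<bar>)) * indicator {0..} n \<partial>count_space (UNIV :: int set))
      + (\<integral>\<^sup>+n. ennreal (h (nat \<bar>n\<bar>)) * indicator {..0} n \<partial>count_space (UNIV :: int set))"
    by (rule nn_integral_add) auto
  also have "\<dots> < \<infinity>"
  proof -
    have "bij_betw int UNIV {0..}"
      by (rule bij_betw_byWitness[where f' = nat]) auto
    moreover have "bij_betw (\<lambda>m. - int m) UNIV {..0}"
      by (rule bij_betw_byWitness[where f' = "\<lambda>n. nat (- n)"]) auto
    ultimately show ?thesis
      using half[of int "{0..}"] half[of "\<lambda>m. - int m" "{..0}"] by simp
  qed
  finally show ?thesis .
qed

text \<open>A two-sided geometric series with ratio \<open>q * exp a\<close>; the hypothesis says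
  that this ratio is below 1.\<close>

lemma lattice_weight_sum_finite:
  assumes "0 < q" "0 \<le> A" "ln q + a < 0"
  obtains S where "0 \<le> S" and
    "(\<integral>\<^sup>+n. ennreal (q powr \<bar>real_of_int n\<bar> * (A * exp (a * \<bar>real_of_int n\<bar>))) \<partial>count_space UNIV) = ennreal S"
proof -
  have eq: "q powr \<bar>real_of_int n\<bar> * (A * exp (a * \<bar>real_of_int n\<bar>)) = A * exp (ln q + a) ^ nat \<bar>n\<bar>" for n
    using \<open>0 < q\<close> by (simp add: powr_def exp_of_nat_mult[symmetric] exp_add[symmetric] algebra_simps)
  have "summable (\<lambda>m. A * exp (ln q + a) ^ m)"
    using assms by (intro summable_mult summable_geometric) simp
  from nn_integral_count_space_int_finite[OF this] \<open>0 \<le> A\<close>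
  have "(\<integral>\<^sup>+n. ennreal (q powr \<bar>real_of_int n\<bar> * (A * exp (a * \<bar>real_of_int n\<bar>))) \<partial>count_space UNIV) < \<infinity>"
    unfolding eq by simp
  then show thesis
    by (intro that[of "enn2real (\<integral>\<^sup>+n. ennreal (q powr \<bar>real_of_int n\<bar> * (A * exp (a * \<bar>real_of_int n\<bar>))) \<partial>count_space UNIV)"])
      (auto simp: less_top)
qed

section \<open>Sobolev and Gevrey bounds\<close>

text \<open>Peetre's inequality, followed by domination of the polynomial in \<open>z\<close> by an
  exponential of arbitrarily small rate \<open>d\<close>. In this form the loss fits into a
  geometric series.\<close>

lemma sobolev_weight_translate:
  fixes d y z s :: real
  assumes "0 < d" "0 \<le> s"
  shows "(1 + (y - z)\<^sup>2) powr s \<le> ((2 + 4 / d\<^sup>2) powr s * exp (d * s * \<bar>z\<bar>)) * (1 + y\<^sup>2) powr s"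
proof -
  have "2 * (1 + z\<^sup>2) * (1 + y\<^sup>2) - (1 + (y - z)\<^sup>2) = 1 + (y + z)\<^sup>2 + 2 * (z\<^sup>2 * y\<^sup>2)"
    by (simp add: power2_eq_square algebra_simps)
  also have "\<dots> \<ge> 0"
    by simp
  finally have "1 + (y - z)\<^sup>2 \<le> 2 * (1 + z\<^sup>2) * (1 + y\<^sup>2)"
    by simp
  also have "2 * (1 + z\<^sup>2) \<le> (2 + 4 / d\<^sup>2) * exp (d * \<bar>z\<bar>)"
  proof -
    \<comment> \<open>The constant is chosen for this: \<open>2\<close> yields the constant term and
      \<open>4 / d\<^sup>2\<close> times the quadratic term is exactly
      \<open>2 * z\<^sup>2\<close>.\<close>
    have "2 * (1 + z\<^sup>2) \<le> (2 + 4 / d\<^sup>2) * (1 + (d * \<bar>z\<bar>)\<^sup>2 / 2)"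
      using assms by (simp add: power_mult_distrib field_simps)
    also have "\<dots> \<le> (2 + 4 / d\<^sup>2) * exp (d * \<bar>z\<bar>)"
    proof (rule mult_left_mono)
      have "0 \<le> d * \<bar>z\<bar>"
        using assms by simp
      with exp_lower_Taylor_quadratic[OF this]
      show "1 + (d * \<bar>z\<bar>)\<^sup>2 / 2 \<le> exp (d * \<bar>z\<bar>)" by linarith
    qed simp
    finally show ?thesis .
  qed
  finally have "1 + (y - z)\<^sup>2 \<le> (2 + 4 / d\<^sup>2) * exp (d * \<bar>z\<bar>) * (1 + y\<^sup>2)"
    by (simp add: mult_right_mono)
  then have "(1 + (y - z)\<^sup>2) powr s \<le> ((2 + 4 / d\<^sup>2) * exp (d * \<bar>z\<bar>) * (1 + y\<^sup>2)) powr s"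
    using assms by (intro powr_mono2) auto
  also have "\<dots> = ((2 + 4 / d\<^sup>2) powr s * exp (d * s * \<bar>z\<bar>)) * (1 + y\<^sup>2) powr s"
    by (simp add: powr_mult exp_powr_real mult_ac)
  finally show ?thesis .
qed

section \<open>Bounds for solutions, pointwise and in the function spaces\<close>

context shear_modes
begin

text \<open>Where the sum is infinite the claim is trivial; elsewhere the lattice sum is itself an
  admissible majorant, so the bound holds with constant 1.\<close>

lemma solution_lattice_bound:
  assumes sol: "solves_system c k f \<omega>" "exp_growth \<omega>" "0 \<le> t" and "2 * pi * c / \<bar>k\<bar> \<le> \<rho>" "0 < \<rho>" "\<rho> \<le> 1"
  shows "ennreal (cmod (\<omega> t x - f x)) \<le> lattice_sum \<rho> (\<lambda>y. cmod (f y)) x"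
proof (cases "lattice_sum \<rho> (\<lambda>y. cmod (f y)) x = \<infinity>")
  case False
  obtain F :: "int \<Rightarrow> real" where F: "ennreal (F 0) = lattice_sum \<rho> (\<lambda>y. cmod (f y)) x"
    "\<And>n. cmod (f (x + of_int n)) \<le> F n" "\<And>n. \<rho> * F (n + 1) \<le> F n" "\<And>n. \<rho> * F (n - 1) \<le> F n"
    using lattice_sum_majorant[OF assms(5,6) norm_ge_zero False] by blast
  show ?thesis
    unfolding F(1)[symmetric] using solution_bound_uniform[OF assms(1-4) F(2-4)] by (rule ennreal_leI)
qed simp

lemma solution_square_bound:
  assumes sol: "solves_system c k f \<omega>" "exp_growth \<omega>" "0 \<le> t" and "2 * pi * c / \<bar>k\<bar> \<le> \<rho>" "0 < \<rho>" "\<rho> \<le> 1"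
  shows "ennreal ((cmod (\<omega> t x))\<^sup>2) \<le> ennreal 4 * lattice_sum (\<rho>\<^sup>2) (\<lambda>y. (cmod (f y))\<^sup>2) x"
proof (cases "lattice_sum (\<rho>\<^sup>2) (\<lambda>y. (cmod (f y))\<^sup>2) x = \<infinity>")
  case False
  obtain G :: "int \<Rightarrow> real" where G: "ennreal ((G 0)\<^sup>2) = lattice_sum (\<rho>\<^sup>2) (\<lambda>y. (cmod (f y))\<^sup>2) x" "0 \<le> G 0"
    "\<And>n. cmod (f (x + of_int n)) \<le> G n" "\<And>n. \<rho> * G (n + 1) \<le> G n" "\<And>n. \<rho> * G (n - 1) \<le> G n"
    using lattice_sum_sqrt_majorant[OF assms(5,6) False] by blast
  \<comment> \<open>\<open>G 0\<close> bounds both the datum and the deviation from it; squaring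
    gives the factor 4.\<close>
  have "cmod (\<omega> t x) \<le> 2 * G 0"
    using solution_bound_uniform[OF assms(1-4) G(3-5)] G(3)[of 0] norm_triangle_sub[of "\<omega> t x" "f x"] by simp
  then have "(cmod (\<omega> t x))\<^sup>2 \<le> (2 * G 0)\<^sup>2"
    by (intro power_mono) auto
  then show ?thesis
    unfolding G(1)[symmetric] by (subst ennreal_mult[symmetric]) (auto intro: ennreal_leI simp: power_mult_distrib)
qed (simp add: ennreal_mult_top)

lemma solution_square_bound_exponential:
  assumes sol: "solves_system c k f \<omega>" "exp_growth \<omega>" "0 \<le> t" and "0 < r" "r \<le> 1"
  shows "ennreal ((cmod (\<omega> t x))\<^sup>2)
    \<le> ennreal ((exp (c / (k\<^sup>2 * r) * t))\<^sup>2) * lattice_sum (r\<^sup>2) (\<lambda>y. (cmod (f y))\<^sup>2) x"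
proof (cases "lattice_sum (r\<^sup>2) (\<lambda>y. (cmod (f y))\<^sup>2) x = \<infinity>")
  case False
  obtain G :: "int \<Rightarrow> real" where G: "ennreal ((G 0)\<^sup>2) = lattice_sum (r\<^sup>2) (\<lambda>y. (cmod (f y))\<^sup>2) x" "0 \<le> G 0"
    "\<And>n. cmod (f (x + of_int n)) \<le> G n" "\<And>n. r * G (n + 1) \<le> G n" "\<And>n. r * G (n - 1) \<le> G n"
    using lattice_sum_sqrt_majorant[OF assms(4,5) False] by blast
  have "(cmod (\<omega> t x))\<^sup>2 \<le> (exp (c / (k\<^sup>2 * r) * t) * G 0)\<^sup>2"
    using solution_bound_exponential[OF assms(1-4) G(3-5)] by (intro power_mono) auto
  then show ?thesis
    unfolding G(1)[symmetric] by (subst ennreal_mult[symmetric]) (auto intro: ennreal_leI simp only: power_mult_distrib zero_le_power2)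
qed (simp add: ennreal_mult_top)

text \<open>The constant involves only \<open>S\<close>, hence only \<open>\<rho>\<close>,
  \<open>d\<close> and \<open>s\<close>: it is uniform in time, in the data and in all
  \<open>k\<close> with the same \<open>\<rho>\<close>.\<close>

lemma Hs_stable:
  assumes sol: "solves_system c k f \<omega>" "exp_growth \<omega>" "0 \<le> t" and \<rho>: "2 * pi * c / \<bar>k\<bar> \<le> \<rho>" "0 < \<rho>" "\<rho> \<le> 1"
    and "0 < d" "0 \<le> s" and S: "0 \<le> S" "(\<integral>\<^sup>+n. ennreal ((\<rho>\<^sup>2) powr \<bar>real_of_int n\<bar> *
      ((2 + 4 / d\<^sup>2) powr s * exp (d * s * \<bar>real_of_int n\<bar>))) \<partial>count_space UNIV) = ennreal S"
    and f: "in_Hs s f"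
  shows "in_Hs s (\<omega> t)" and "Hs_norm s (\<omega> t) \<le> sqrt (4 * S) * Hs_norm s f"
proof -
  have meas: "f \<in> borel_measurable lebesgue" and
    int: "integrable lebesgue (\<lambda>x. (1 + x\<^sup>2) powr s * (cmod (f x))\<^sup>2)"
    using f by (simp_all add: in_Hs_def)
  have meas': "\<omega> t \<in> borel_measurable lebesgue"
    by (rule solution_measurable[OF sol meas])
  have w: "(\<lambda>x::real. (1 + x\<^sup>2) powr s) \<in> borel_measurable lebesgue"
    by (rule measurable_completion) simp
  note * = weighted_integral_le[OF meas' meas w powr_ge_zero sobolev_weight_translate[OF \<open>0 < d\<close> \<open>0 \<le> s\<close>] _
      S(2,1) solution_square_bound[OF sol \<rho>] _ int]
  show "in_Hs s (\<omega> t)"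
    using meas' *(1) by (simp add: in_Hs_def)
  show "Hs_norm s (\<omega> t) \<le> sqrt (4 * S) * Hs_norm s f"
    unfolding Hs_norm_def real_sqrt_mult[symmetric] using *(2) by (intro real_sqrt_le_mono) simp
qed

lemma Gevrey_preserved:
  assumes sol: "solves_system c k f \<omega>" "exp_growth \<omega>" "0 \<le> t" and "0 < C" and f: "in_Gevrey C f"
  shows "in_Gevrey C (\<omega> t)"
proof -
  \<comment> \<open>With this choice \<open>r\<^sup>2 * exp C = exp (- C) < 1\<close>, so the
    weighted lattice series converges. The constant then depends on \<open>t\<close>, which
    membership at each time permits.\<close>
  define r where "r = exp (- C)"
  have r: "0 < r" "r \<le> 1"
    using \<open>0 < C\<close> by (simp_all add: r_def)
  have "0 < r\<^sup>2" "ln (r\<^sup>2) + C < 0"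
    using \<open>0 < C\<close> r by (simp_all add: ln_realpow) (simp add: r_def)
  from lattice_weight_sum_finite[OF this(1) zero_le_one this(2)]
  obtain S where S: "0 \<le> S" "(\<integral>\<^sup>+n. ennreal ((r\<^sup>2) powr \<bar>real_of_int n\<bar> *
      (1 * exp (C * \<bar>real_of_int n\<bar>))) \<partial>count_space UNIV) = ennreal S"
    by blast
  have meas: "f \<in> borel_measurable lebesgue" and int: "integrable lebesgue (\<lambda>x. exp (C * \<bar>x\<bar>) * (cmod (f x))\<^sup>2)"
    using f by (simp_all add: in_Gevrey_def)
  have meas': "\<omega> t \<in> borel_measurable lebesgue"
    by (rule solution_measurable[OF sol meas])
  have w: "(\<lambda>x::real. exp (C * \<bar>x\<bar>)) \<in> borel_measurable lebesgue"
    by (rule measurable_completion) simp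
  have W: "exp (C * \<bar>y - real_of_int n\<bar>) \<le> 1 * exp (C * \<bar>real_of_int n\<bar>) * exp (C * \<bar>y\<bar>)" for n y
    using \<open>0 < C\<close> abs_triangle_ineq4[of y "real_of_int n"]
    by (simp add: exp_add[symmetric] distrib_left[symmetric])
  show ?thesis
    unfolding in_Gevrey_def
    using meas' weighted_integral_le(1)[OF meas' meas w exp_ge_zero W _ S(2,1) solution_square_bound_exponential[OF sol r] _ int]
    by simp
qed

end

theorem theorem7:
  fixes c L :: real
  assumes "c > 0" and "L > 0" and "2 * pi * c * L < 1"
  shows
    "(\<forall>k\<in>x_freqs L. \<forall>\<omega>\<^sub>0 \<omega>. solves_system c k \<omega>\<^sub>0 \<omega> \<longrightarrow> exp_growth \<omega> \<longrightarrow>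
        (\<forall>\<tau>\<ge>0. \<forall>\<eta>.
           ennreal (cmod (\<omega> \<tau> \<eta> - \<omega>\<^sub>0 \<eta>))
             \<le> ennreal (1 / (1 - 2 * pi * c * L))
               * freq_conv (\<lambda>m. (2 * pi * c * L) powr \<bar>m\<bar>) (\<lambda>\<eta>\<^sub>0. cmod (\<omega>\<^sub>0 \<eta>\<^sub>0)) \<eta>))
     \<and> (\<forall>s>0. \<exists>C\<^sub>s. \<forall>k\<in>x_freqs L. \<forall>\<omega>\<^sub>0 \<omega>. solves_system c k \<omega>\<^sub>0 \<omega> \<longrightarrow> exp_growth \<omega> \<longrightarrow>
          in_Hs s \<omega>\<^sub>0 \<longrightarrow>
          (\<forall>\<tau>\<ge>0. in_Hs s (\<omega> \<tau>) \<and> Hs_norm s (\<omega> \<tau>) \<le> C\<^sub>s * Hs_norm s \<omega>\<^sub>0))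
     \<and> (\<exists>C\<^sub>0. \<forall>k\<in>x_freqs L. \<forall>\<omega>\<^sub>0 \<omega>. solves_system c k \<omega>\<^sub>0 \<omega> \<longrightarrow> exp_growth \<omega> \<longrightarrow>
          (\<forall>C>C\<^sub>0. in_Gevrey C \<omega>\<^sub>0 \<longrightarrow> (\<forall>\<tau>\<ge>0. in_Gevrey (C - C\<^sub>0) (\<omega> \<tau>))))"
proof -
  define \<rho> where "\<rho> = 2 * pi * c * L"
  have \<rho>: "0 < \<rho>" "\<rho> < 1"
    using assms by (simp_all add: \<rho>_def)
  have modes: "shear_modes c k" and freq: "2 * pi * c / \<bar>k\<bar> \<le> \<rho>" if k: "k \<in> x_freqs L" for k
  proof -
    obtain m :: int where m: "k = of_int m / L" "m \<noteq> 0"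
      using k unfolding x_freqs_def by blast
    then show "shear_modes c k"
      using assms by unfold_locales auto
    \<comment> \<open>The smallest nonzero frequency has modulus \<open>1 / L\<close>, the worst
      case for the coupling.\<close>
    have "1 \<le> \<bar>real_of_int m\<bar>"
      using m by simp
    then have "2 * pi * c * L / \<bar>real_of_int m\<bar> \<le> 2 * pi * c * L / 1"
      using assms by (intro divide_left_mono) auto
    then show "2 * pi * c / \<bar>k\<bar> \<le> \<rho>"
      using m assms by (simp add: \<rho>_def abs_divide)
  qed
  have "ennreal (cmod (\<omega> \<tau> \<eta> - \<omega>\<^sub>0 \<eta>))
      \<le> ennreal (1 / (1 - \<rho>)) * freq_conv (\<lambda>m. \<rho> powr \<bar>m\<bar>) (\<lambda>\<eta>\<^sub>0. cmod (\<omega>\<^sub>0 \<eta>\<^sub>0)) \<eta>"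
    if k: "k \<in> x_freqs L" and sol: "solves_system c k \<omega>\<^sub>0 \<omega>" "exp_growth \<omega>" "0 \<le> \<tau>" for k \<omega>\<^sub>0 \<omega> \<tau> \<eta>
  proof -
    have "ennreal (cmod (\<omega> \<tau> \<eta> - \<omega>\<^sub>0 \<eta>)) \<le> 1 * freq_conv (\<lambda>m. \<rho> powr \<bar>m\<bar>) (\<lambda>\<eta>\<^sub>0. cmod (\<omega>\<^sub>0 \<eta>\<^sub>0)) \<eta>"
      using order_trans[OF shear_modes.solution_lattice_bound[OF modes[OF k] sol freq[OF k] \<rho>(1)] lattice_sum_le_freq_conv] \<rho>
      by simp
    \<comment> \<open>The constant 1 is weakened to the stated one, as
      \<open>0 < \<rho> < 1\<close>.\<close>
    also have "\<dots> \<le> ennreal (1 / (1 - \<rho>)) * freq_conv (\<lambda>m. \<rho> powr \<bar>m\<bar>) (\<lambda>\<eta>\<^sub>0. cmod (\<omega>\<^sub>0 \<eta>\<^sub>0)) \<eta>"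
      using \<rho> by (intro mult_right_mono) (simp_all add: field_simps)
    finally show ?thesis .
  qed
  moreover have "\<exists>C\<^sub>s. \<forall>k\<in>x_freqs L. \<forall>\<omega>\<^sub>0 \<omega>. solves_system c k \<omega>\<^sub>0 \<omega> \<longrightarrow> exp_growth \<omega> \<longrightarrow>
      in_Hs s \<omega>\<^sub>0 \<longrightarrow> (\<forall>\<tau>\<ge>0. in_Hs s (\<omega> \<tau>) \<and> Hs_norm s (\<omega> \<tau>) \<le> C\<^sub>s * Hs_norm s \<omega>\<^sub>0)"
    if "0 < s" for s
  proof -
    \<comment> \<open>Then \<open>ln (\<rho>\<^sup>2) + d * s = ln \<rho> < 0\<close>. As
      \<open>d\<close> and \<open>S\<close> are fixed before \<open>k\<close>, the constant is the
      same for all frequencies.\<close>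
    define d where "d = - ln \<rho> / s"
    have d: "0 < d" and q: "0 < \<rho>\<^sup>2" and neg: "ln (\<rho>\<^sup>2) + d * s < 0"
      using \<rho> \<open>0 < s\<close> by (simp_all add: d_def ln_realpow divide_neg_pos)
    obtain S where S: "0 \<le> S" "(\<integral>\<^sup>+n. ennreal ((\<rho>\<^sup>2) powr \<bar>real_of_int n\<bar> *
        ((2 + 4 / d\<^sup>2) powr s * exp (d * s * \<bar>real_of_int n\<bar>))) \<partial>count_space UNIV) = ennreal S"
      using lattice_weight_sum_finite[OF q powr_ge_zero neg] by blast
    show ?thesis
      using shear_modes.Hs_stable[OF modes _ _ _ freq \<rho>(1) less_imp_le[OF \<rho>(2)] d less_imp_le[OF \<open>0 < s\<close>] S]
      by blast
  qed
  moreover have "\<exists>C\<^sub>0. \<forall>k\<in>x_freqs L. \<forall>\<omega>\<^sub>0 \<omega>. solves_system c k \<omega>\<^sub>0 \<omega> \<longrightarrow> exp_growth \<omega> \<longrightarrow>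
      (\<forall>C>C\<^sub>0. in_Gevrey C \<omega>\<^sub>0 \<longrightarrow> (\<forall>\<tau>\<ge>0. in_Gevrey (C - C\<^sub>0) (\<omega> \<tau>)))"
    using shear_modes.Gevrey_preserved[OF modes] by (intro exI[of _ 0]) simp
  ultimately show ?thesis
    unfolding \<rho>_def by blast
qed

end
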